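(* Assume the set of atoms is finite. For every finite set of formulas $\Gamma$ and every formula $A$, there is a finite set $\Pi$ of $\Gamma$-projective formulas such that (1) $\vdash\bigvee\Pi\to A$, and (2) $A\mathrel{|\!\sim_{\Gamma}}\Pi$.
   Context: The language $\mathcal{L}$ is built from atoms ${\sf atom}={\sf var}\cup{\sf par}$ (variables and parameters, disjoint), ${\sf atom}$ finite, using $\bot,\wedge,\vee,\to$; $\bigvee\emptyset:=\bot$. $\mathcal{L}({\sf par})$ is the set of formulas whose atoms are all parameters. A substitution is a map $\theta:\mathcal{L}\to\mathcal{L}$ commuting with connectives with $\theta(p)=p$ for $p\in{\sf par}$. $\vdash$ is intuitionistic derivability. For $E\in\mathcal{L}({\sf par})$, a formula $B$ is $E$-projective if there is $\theta$ with $B\vdash\theta(a)\leftrightarrow a$ for every atom $a$ and $\vdash\theta(B)\leftrightarrow E$; $B$ is $\Gamma$-projective if it is $E$-projective for some $E\in\Gamma\cap\mathcal{L}({\sf par})$. $A\mathrel{|\!\sim_{\Gamma}}\Pi$ means: for every $E\in\Gamma\cap\mathcal{L}({\sf par})$ and every substitution $\theta$ with $\vdash E\to\theta(A)$, there exists $B\in\Pi$ with $\vdash E\to\theta(B)$. *)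

theory Defs
  imports Main
begin

datatype (atoms: 'a) fm =
    Atom 'a
  | Falsum                    ("\<^bold>\<bottom>")
  | Conj "'a fm" "'a fm"      (infixr "\<^bold>\<and>" 75)
  | Disj "'a fm" "'a fm"      (infixr "\<^bold>\<or>" 70)
  | Imp "'a fm" "'a fm"       (infixr "\<^bold>\<longrightarrow>" 65)

definition Iff :: "'a fm \<Rightarrow> 'a fm \<Rightarrow> 'a fm" (infix "\<^bold>\<longleftrightarrow>" 60) where
  "A \<^bold>\<longleftrightarrow> B = (A \<^bold>\<longrightarrow> B) \<^bold>\<and> (B \<^bold>\<longrightarrow> A)"

text \<open>The sets of variables and parameters are arbitrary (possibly empty) sets inside an
  ambient type, so the language over a set of atoms is a carrier set of formulas.\<close>

definition lang :: "'a set \<Rightarrow> 'a fm set" where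
  "lang S = {A. atoms A \<subseteq> S}"

text \<open>The enumeration of the finite set is an arbitrary choice, which is
  immaterial up to provable equivalence; the empty disjunction is falsum. The value is
  meaningful only for finite sets.\<close>

definition BigDisj :: "'a fm set \<Rightarrow> 'a fm" ("\<^bold>\<Or>_" [80] 80) where
  "\<^bold>\<Or>S = foldr Disj (SOME xs. distinct xs \<and> set xs = S) \<^bold>\<bottom>"

inductive derivable :: "'a fm set \<Rightarrow> 'a fm \<Rightarrow> bool" (infix "\<turnstile>" 50) where
  Assm: "A \<in> H \<Longrightarrow> H \<turnstile> A"
| FalsumE: "H \<turnstile> \<^bold>\<bottom> \<Longrightarrow> H \<turnstile> A"
| ConjI: "H \<turnstile> A \<Longrightarrow> H \<turnstile> B \<Longrightarrow> H \<turnstile> A \<^bold>\<and> B"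
| ConjE1: "H \<turnstile> A \<^bold>\<and> B \<Longrightarrow> H \<turnstile> A"
| ConjE2: "H \<turnstile> A \<^bold>\<and> B \<Longrightarrow> H \<turnstile> B"
| DisjI1: "H \<turnstile> A \<Longrightarrow> H \<turnstile> A \<^bold>\<or> B"
| DisjI2: "H \<turnstile> B \<Longrightarrow> H \<turnstile> A \<^bold>\<or> B"
| DisjE: "H \<turnstile> A \<^bold>\<or> B \<Longrightarrow> insert A H \<turnstile> C \<Longrightarrow> insert B H \<turnstile> C \<Longrightarrow> H \<turnstile> C"
| ImpI: "insert A H \<turnstile> B \<Longrightarrow> H \<turnstile> A \<^bold>\<longrightarrow> B"
| ImpE: "H \<turnstile> A \<^bold>\<longrightarrow> B \<Longrightarrow> H \<turnstile> A \<Longrightarrow> H \<turnstile> B"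

text \<open>A substitution maps the language to itself; its values
  on formulas outside the language are irrelevant.\<close>

definition substitution :: "'a set \<Rightarrow> 'a set \<Rightarrow> ('a fm \<Rightarrow> 'a fm) \<Rightarrow> bool" where
  "substitution var par \<theta> \<longleftrightarrow>
     (\<forall>A \<in> lang (var \<union> par). \<theta> A \<in> lang (var \<union> par)) \<and>
     \<theta> \<^bold>\<bottom> = \<^bold>\<bottom> \<and>
     (\<forall>A \<in> lang (var \<union> par). \<forall>B \<in> lang (var \<union> par).
        \<theta> (A \<^bold>\<and> B) = \<theta> A \<^bold>\<and> \<theta> B \<and>
        \<theta> (A \<^bold>\<or> B) = \<theta> A \<^bold>\<or> \<theta> B \<and>
        \<theta> (A \<^bold>\<longrightarrow> B) = \<theta> A \<^bold>\<longrightarrow> \<theta> B) \<and>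
     (\<forall>p \<in> par. \<theta> (Atom p) = Atom p)"

definition projective :: "'a set \<Rightarrow> 'a set \<Rightarrow> 'a fm \<Rightarrow> 'a fm \<Rightarrow> bool" where
  "projective var par E B \<longleftrightarrow>
     B \<in> lang (var \<union> par) \<and>
     (\<exists>\<theta>. substitution var par \<theta> \<and>
          (\<forall>a \<in> var \<union> par. {B} \<turnstile> \<theta> (Atom a) \<^bold>\<longleftrightarrow> Atom a) \<and>
          {} \<turnstile> \<theta> B \<^bold>\<longleftrightarrow> E)"

definition set_projective :: "'a set \<Rightarrow> 'a set \<Rightarrow> 'a fm set \<Rightarrow> 'a fm \<Rightarrow> bool" where
  "set_projective var par \<Gamma> B \<longleftrightarrow> (\<exists>E \<in> \<Gamma> \<inter> lang par. projective var par E B)"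

definition admissible :: "'a set \<Rightarrow> 'a set \<Rightarrow> 'a fm set \<Rightarrow> 'a fm \<Rightarrow> 'a fm set \<Rightarrow> bool" where
  "admissible var par \<Gamma> A \<Pi> \<longleftrightarrow>
     (\<forall>E \<in> \<Gamma> \<inter> lang par. \<forall>\<theta>. substitution var par \<theta> \<longrightarrow> {} \<turnstile> E \<^bold>\<longrightarrow> \<theta> A \<longrightarrow>
        (\<exists>B \<in> \<Pi>. {} \<turnstile> E \<^bold>\<longrightarrow> \<theta> B))"

end

theory Submission
  imports Defs
begin

text \<open>
  Formulas are interpreted in finite trees, and a substitution acts on trees by changing the
  valuation of every node. It suffices to treat a single \<open>E\<close>. Fix a finite set \<open>\<Sigma>\<close> of formulas, closed
  under subformulas and containing \<open>A\<close>, \<open>E\<close> and all atoms, and call the set of formulas of \<open>\<Sigma>\<close> forced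
  at a node its type. Given \<open>\<theta>\<close> with \<open>\<turnstile> E \<^bold>\<longrightarrow> \<theta> A\<close>, let \<open>B\<close> say that every node has a type occurring in
  the \<open>\<theta>\<close>-images of models of \<open>E\<close>; there are finitely many such \<open>B\<close>, and \<open>B \<turnstile> A\<close>, \<open>\<turnstile> E \<^bold>\<longrightarrow> \<theta> B\<close>.
  As the type of a node is determined by its valuation and the types of its immediate successors, models of \<open>B\<close> have
  the extension property: a new root that forces \<open>E\<close> can be made to force \<open>B\<close> by revaluing variables.

  For such \<open>B\<close>, apply again and again Ghilardi's substitutions \<open>a \<mapsto> B \<^bold>\<longrightarrow> a\<close> (for \<open>a \<in> X\<close>),
  \<open>a \<mapsto> B \<^bold>\<and> a\<close> (for \<open>a \<notin> X\<close>) for all sets \<open>X\<close> of variables. They leave nodes forcing \<open>B\<close> unchanged, and a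
  node forcing \<open>E\<close> all of whose successors force \<open>B\<close> is repaired by one of them. The number of rounds
  that a tree needs is bounded in terms of the subformulas of \<open>B\<close> and the parameters alone.
\<close>

section \<open>Derivability\<close>

lemma derivable_cut: "H \<turnstile> A \<Longrightarrow> insert A H \<turnstile> B \<Longrightarrow> H \<turnstile> B"
  by (blast intro: derivable.intros)

primrec subfms :: "'a fm \<Rightarrow> 'a fm set" where
  "subfms (Atom a) = {Atom a}"
| "subfms \<^bold>\<bottom> = {\<^bold>\<bottom>}"
| "subfms (A \<^bold>\<and> B) = insert (A \<^bold>\<and> B) (subfms A \<union> subfms B)"
| "subfms (A \<^bold>\<or> B) = insert (A \<^bold>\<or> B) (subfms A \<union> subfms B)"
| "subfms (A \<^bold>\<longrightarrow> B) = insert (A \<^bold>\<longrightarrow> B) (subfms A \<union> subfms B)"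

definition sub_closed :: "'a fm set \<Rightarrow> bool" where
  "sub_closed \<Sigma> \<longleftrightarrow> (\<forall>A \<in> \<Sigma>. subfms A \<subseteq> \<Sigma>)"

lemma self_in_subfms [simp]: "A \<in> subfms A"
  by (cases A) auto

lemma finite_subfms [simp]: "finite (subfms A)"
  by (induction A) auto

lemma subfms_trans: "B \<in> subfms A \<Longrightarrow> subfms B \<subseteq> subfms A"
  by (induction A) auto

lemma sub_closed_subfms [simp]: "sub_closed (subfms A)"
  by (simp add: sub_closed_def subfms_trans)

lemma sub_closed_Un: "sub_closed S \<Longrightarrow> sub_closed T \<Longrightarrow> sub_closed (S \<union> T)"
  by (auto simp: sub_closed_def)

lemma sub_closed_UN: "(\<And>i. i \<in> I \<Longrightarrow> sub_closed (S i)) \<Longrightarrow> sub_closed (\<Union>i\<in>I. S i)"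
  by (force simp: sub_closed_def)

lemma sub_closed_Atoms [simp]: "sub_closed (Atom ` S)"
  by (auto simp: sub_closed_def)

lemma sub_closedD:
  assumes "sub_closed \<Sigma>"
  shows "A \<^bold>\<and> B \<in> \<Sigma> \<Longrightarrow> A \<in> \<Sigma> \<and> B \<in> \<Sigma>"
    and "A \<^bold>\<or> B \<in> \<Sigma> \<Longrightarrow> A \<in> \<Sigma> \<and> B \<in> \<Sigma>"
    and "A \<^bold>\<longrightarrow> B \<in> \<Sigma> \<Longrightarrow> A \<in> \<Sigma> \<and> B \<in> \<Sigma>"
  using assms unfolding sub_closed_def by (fastforce dest: bspec)+

lemma lang_simps [simp]:
  "Atom a \<in> lang S \<longleftrightarrow> a \<in> S"
  "\<^bold>\<bottom> \<in> lang S"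
  "A \<^bold>\<and> B \<in> lang S \<longleftrightarrow> A \<in> lang S \<and> B \<in> lang S"
  "A \<^bold>\<or> B \<in> lang S \<longleftrightarrow> A \<in> lang S \<and> B \<in> lang S"
  "A \<^bold>\<longrightarrow> B \<in> lang S \<longleftrightarrow> A \<in> lang S \<and> B \<in> lang S"
  by (auto simp: lang_def)

lemma lang_mono: "S \<subseteq> T \<Longrightarrow> lang S \<subseteq> lang T"
  by (auto simp: lang_def)

lemma subfms_lang: "A \<in> lang S \<Longrightarrow> subfms A \<subseteq> lang S"
  by (induction A) auto

lemma sub_closed_lang: "sub_closed (lang S)"
  by (simp add: sub_closed_def subfms_lang)

lemma sub_closed_Int: "sub_closed S \<Longrightarrow> sub_closed T \<Longrightarrow> sub_closed (S \<inter> T)"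
  by (auto simp: sub_closed_def)

section \<open>Finite tree models\<close>

text \<open>Trees rather than partial orders: models can be glued under a new root without
  identifying nodes, and structural induction runs from the leaves down.\<close>

datatype 'a tree = Node (root: "'a set") (kids: "'a tree list")

fun subtrees :: "'a tree \<Rightarrow> 'a tree set" where
  "subtrees (Node V ts) = insert (Node V ts) (\<Union>s\<in>set ts. subtrees s)"

fun persistent :: "'a tree \<Rightarrow> bool" where
  "persistent (Node V ts) \<longleftrightarrow> (\<forall>s\<in>set ts. V \<subseteq> root s \<and> persistent s)"

primrec forces :: "'a tree \<Rightarrow> 'a fm \<Rightarrow> bool" (infix "\<tturnstile>" 50) where
  "t \<tturnstile> Atom a \<longleftrightarrow> a \<in> root t"
| "t \<tturnstile> \<^bold>\<bottom> \<longleftrightarrow> False"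
| "t \<tturnstile> A \<^bold>\<and> B \<longleftrightarrow> t \<tturnstile> A \<and> t \<tturnstile> B"
| "t \<tturnstile> A \<^bold>\<or> B \<longleftrightarrow> t \<tturnstile> A \<or> t \<tturnstile> B"
| "t \<tturnstile> A \<^bold>\<longrightarrow> B \<longleftrightarrow> (\<forall>s\<in>subtrees t. s \<tturnstile> A \<longrightarrow> s \<tturnstile> B)"

lemma self_in_subtrees [simp]: "t \<in> subtrees t"
  by (cases t) auto

lemma kid_in_subtrees: "s \<in> set (kids t) \<Longrightarrow> s \<in> subtrees t"
  by (cases t) force

lemma subtrees_trans: "s \<in> subtrees t \<Longrightarrow> subtrees s \<subseteq> subtrees t"
  by (induction t) fastforce

text \<open>In a finite tree a failure can be followed upwards until no immediate successor
  fails.\<close>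

lemma minimal_failure:
  "\<not> P t \<Longrightarrow> \<exists>s\<in>subtrees t. \<not> P s \<and> (\<forall>c\<in>set (kids s). P c)"
proof (induction t)
  case (Node V ts)
  show ?case
  proof (cases "\<forall>c\<in>set ts. P c")
    case True
    then show ?thesis using Node.prems by force
  next
    case False
    then show ?thesis using Node.IH by fastforce
  qed
qed

lemma forces_Imp_Node:
  "Node V ts \<tturnstile> A \<^bold>\<longrightarrow> B \<longleftrightarrow>
     (Node V ts \<tturnstile> A \<longrightarrow> Node V ts \<tturnstile> B) \<and> (\<forall>s\<in>set ts. s \<tturnstile> A \<^bold>\<longrightarrow> B)"
  by auto

lemma persistent_subtree: "s \<in> subtrees t \<Longrightarrow> persistent t \<Longrightarrow> persistent s \<and> root t \<subseteq> root s"
  by (induction t) fastforce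

lemma forces_subtree: "t \<tturnstile> A \<Longrightarrow> persistent t \<Longrightarrow> s \<in> subtrees t \<Longrightarrow> s \<tturnstile> A"
proof (induction A)
  case (Atom a)
  then show ?case using persistent_subtree[of s t] by auto
next
  case (Imp A B)
  then show ?case using subtrees_trans[of s t] by auto
qed auto

lemma soundness: "H \<turnstile> A \<Longrightarrow> persistent t \<Longrightarrow> \<forall>C\<in>H. t \<tturnstile> C \<Longrightarrow> t \<tturnstile> A"
proof (induction arbitrary: t rule: derivable.induct)
  case (ImpI A H B)
  then show ?case by (auto intro: forces_subtree dest: persistent_subtree)
next
  case (ImpE H A B)
  have "t \<tturnstile> A \<^bold>\<longrightarrow> B" "t \<tturnstile> A" using ImpE by blast+
  then show ?case by auto
next
  case (DisjE H A B C)
  have "t \<tturnstile> A \<or> t \<tturnstile> B" using DisjE.IH(1)[OF DisjE.prems] by simp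
  then show ?case using DisjE by auto
qed auto

section \<open>Prime theories and completeness for finite trees\<close>

definition prime_theory :: "'a fm set \<Rightarrow> 'a fm set \<Rightarrow> bool" where
  "prime_theory \<Sigma> \<Delta> \<longleftrightarrow> \<Delta> \<subseteq> \<Sigma> \<and> \<not> \<Delta> \<turnstile> \<^bold>\<bottom> \<and> (\<forall>A\<in>\<Sigma>. \<Delta> \<turnstile> A \<longrightarrow> A \<in> \<Delta>) \<and>
     (\<forall>A B. A \<^bold>\<or> B \<in> \<Delta> \<longrightarrow> A \<in> \<Delta> \<or> B \<in> \<Delta>)"

text \<open>Lindenbaum's lemma inside \<open>\<Sigma>\<close>: a maximal set not deriving
  \<open>D\<close> derives it once any further formula of \<open>\<Sigma>\<close> is added; closure
  and primeness follow.\<close>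

lemma prime_extension:
  assumes "finite \<Sigma>" "sub_closed \<Sigma>" "H \<subseteq> \<Sigma>" "\<not> H \<turnstile> D"
  obtains \<Delta> where "prime_theory \<Sigma> \<Delta>" "H \<subseteq> \<Delta>" "\<not> \<Delta> \<turnstile> D"
proof -
  let ?F = "{\<Delta>. \<Delta> \<subseteq> \<Sigma> \<and> H \<subseteq> \<Delta> \<and> \<not> \<Delta> \<turnstile> D}"
  have "finite ?F" using assms(1) by (auto intro: finite_subset[of _ "Pow \<Sigma>"])
  moreover have "H \<in> ?F" using assms by auto
  ultimately obtain \<Delta> where \<Delta>: "\<Delta> \<in> ?F" and max: "\<forall>\<Delta>'\<in>?F. \<Delta> \<subseteq> \<Delta>' \<longrightarrow> \<Delta> = \<Delta>'"
    using finite_has_maximal[of ?F] by blast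
  have ins: "insert A \<Delta> \<turnstile> D" if "A \<in> \<Sigma>" "A \<notin> \<Delta>" for A
    using max[rule_format, of "insert A \<Delta>"] \<Delta> that by blast
  have "\<not> \<Delta> \<turnstile> \<^bold>\<bottom>" using \<Delta> FalsumE by blast
  moreover have "A \<in> \<Delta>" if "A \<in> \<Sigma>" "\<Delta> \<turnstile> A" for A
    using \<Delta> ins derivable_cut that by blast
  moreover have "A \<in> \<Delta> \<or> B \<in> \<Delta>" if AB: "A \<^bold>\<or> B \<in> \<Delta>" for A B
  proof (rule ccontr)
    assume "\<not> ?thesis"
    moreover have "A \<in> \<Sigma>" "B \<in> \<Sigma>" using AB \<Delta> sub_closedD[OF assms(2)] by blast+
    ultimately have "\<Delta> \<turnstile> D" using ins Assm[OF AB] DisjE by blast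
    then show False using \<Delta> by blast
  qed
  ultimately have "prime_theory \<Sigma> \<Delta>" using \<Delta> by (auto simp: prime_theory_def)
  then show ?thesis using that \<Delta> by blast
qed

text \<open>The canonical model unravelled: the successors realise all strictly larger prime
  theories. Finiteness of \<open>\<Sigma>\<close> keeps the tree finite and lets the induction run
  on the number of missing formulas.\<close>

lemma prime_theory_realised:
  assumes "finite \<Sigma>" "sub_closed \<Sigma>" "prime_theory \<Sigma> \<Delta>"
  shows "\<exists>t. persistent t \<and> (\<forall>C\<in>\<Sigma>. t \<tturnstile> C \<longleftrightarrow> C \<in> \<Delta>)"
  using assms(3)
proof (induction "card (\<Sigma> - \<Delta>)" arbitrary: \<Delta> rule: less_induct)
  case less
  let ?F = "{\<Delta>'. prime_theory \<Sigma> \<Delta>' \<and> \<Delta> \<subset> \<Delta>'}"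
  have "\<exists>t. persistent t \<and> (\<forall>C\<in>\<Sigma>. t \<tturnstile> C \<longleftrightarrow> C \<in> \<Delta>')" if "\<Delta>' \<in> ?F" for \<Delta>'
  proof (rule less.hyps)
    show "prime_theory \<Sigma> \<Delta>'" using that by blast
    have "\<Sigma> - \<Delta>' \<subset> \<Sigma> - \<Delta>" using that by (auto simp: prime_theory_def)
    then show "card (\<Sigma> - \<Delta>') < card (\<Sigma> - \<Delta>)"
      using assms(1) by (simp add: psubset_card_mono)
  qed
  then obtain T where T: "\<And>\<Delta>'. \<Delta>' \<in> ?F \<Longrightarrow> persistent (T \<Delta>') \<and> (\<forall>C\<in>\<Sigma>. T \<Delta>' \<tturnstile> C \<longleftrightarrow> C \<in> \<Delta>')"
    by metis
  have "finite ?F"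
    using assms(1) by (auto simp: prime_theory_def intro: finite_subset[of _ "Pow \<Sigma>"])
  then obtain ds where ds: "set ds = ?F" using finite_list by blast
  define t where "t = Node {a. Atom a \<in> \<Delta>} (map T ds)"
  have D: "\<Delta> \<subseteq> \<Sigma>" "\<not> \<Delta> \<turnstile> \<^bold>\<bottom>" "\<And>C. C \<in> \<Sigma> \<Longrightarrow> \<Delta> \<turnstile> C \<Longrightarrow> C \<in> \<Delta>"
    "\<And>A B. A \<^bold>\<or> B \<in> \<Delta> \<Longrightarrow> A \<in> \<Delta> \<or> B \<in> \<Delta>"
    using less.prems by (auto simp: prime_theory_def)
  have "{a. Atom a \<in> \<Delta>} \<subseteq> root (T \<Delta>')" if "\<Delta>' \<in> ?F" for \<Delta>'
  proof
    fix a assume "a \<in> {a. Atom a \<in> \<Delta>}"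
    then have "Atom a \<in> \<Sigma>" "Atom a \<in> \<Delta>'" using D(1) that by auto
    then have "T \<Delta>' \<tturnstile> Atom a" using T[OF that] by blast
    then show "a \<in> root (T \<Delta>')" by simp
  qed
  then have "persistent t" using T ds by (auto simp: t_def)
  moreover have "t \<tturnstile> C \<longleftrightarrow> C \<in> \<Delta>" if "C \<in> \<Sigma>" for C
    using that
  proof (induction C)
    case (Atom a)
    show ?case by (simp add: t_def)
  next
    case Falsum
    show ?case using D(2) Assm by auto
  next
    case (Conj A B)
    then have AB: "A \<in> \<Sigma>" "B \<in> \<Sigma>" using sub_closedD[OF assms(2)] by blast+
    have "A \<^bold>\<and> B \<in> \<Delta> \<longleftrightarrow> A \<in> \<Delta> \<and> B \<in> \<Delta>"
      using D(3)[OF AB(1)] D(3)[OF AB(2)] D(3)[OF Conj.prems]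
      by (blast intro: Assm ConjI ConjE1 ConjE2)
    then show ?case using Conj AB by simp
  next
    case (Disj A B)
    then have AB: "A \<in> \<Sigma>" "B \<in> \<Sigma>" using sub_closedD[OF assms(2)] by blast+
    have "A \<^bold>\<or> B \<in> \<Delta> \<longleftrightarrow> A \<in> \<Delta> \<or> B \<in> \<Delta>"
      using D(4) D(3)[OF Disj.prems] by (blast intro: Assm DisjI1 DisjI2)
    then show ?case using Disj AB by simp
  next
    case (Imp A B)
    then have AB: "A \<in> \<Sigma>" "B \<in> \<Sigma>" using sub_closedD[OF assms(2)] by blast+
    have IH: "t \<tturnstile> A \<longleftrightarrow> A \<in> \<Delta>" "t \<tturnstile> B \<longleftrightarrow> B \<in> \<Delta>" using Imp AB by blast+
    show ?case
    proof
      assume imp: "A \<^bold>\<longrightarrow> B \<in> \<Delta>"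
      have "A \<in> \<Delta> \<longrightarrow> B \<in> \<Delta>" using D(3)[OF AB(2)] imp by (blast intro: Assm ImpE)
      moreover have "T \<Delta>' \<tturnstile> A \<^bold>\<longrightarrow> B" if "\<Delta>' \<in> ?F" for \<Delta>'
        using T[OF that] that imp Imp.prems by blast
      ultimately show "t \<tturnstile> A \<^bold>\<longrightarrow> B"
        unfolding t_def forces_Imp_Node using ds IH by (auto simp: t_def)
    next
      assume forced: "t \<tturnstile> A \<^bold>\<longrightarrow> B"
      show "A \<^bold>\<longrightarrow> B \<in> \<Delta>"
      proof (rule ccontr)
        assume "A \<^bold>\<longrightarrow> B \<notin> \<Delta>"
        then have "\<not> insert A \<Delta> \<turnstile> B" using D(3)[OF Imp.prems] ImpI by blast
        moreover have "insert A \<Delta> \<subseteq> \<Sigma>" using AB D(1) by simp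
        ultimately obtain \<Delta>' where
          \<Delta>': "prime_theory \<Sigma> \<Delta>'" "insert A \<Delta> \<subseteq> \<Delta>'" "\<not> \<Delta>' \<turnstile> B"
          using prime_extension[OF assms(1,2)] by metis
        then have "B \<notin> \<Delta>'" using Assm by blast
        \<comment> \<open>If the extension added nothing, \<open>A\<close> was in
          \<open>\<Delta>\<close> already and the root itself refutes the implication; otherwise a
          successor does.\<close>
        show False
        proof (cases "\<Delta>' = \<Delta>")
          case True
          then have "t \<tturnstile> A" "\<not> t \<tturnstile> B" using IH \<Delta>' \<open>B \<notin> \<Delta>'\<close> by auto
          then show False using forced by auto
        next
          case False
          then have F: "\<Delta>' \<in> ?F" using \<Delta>' by auto
          then have "T \<Delta>' \<tturnstile> A" "\<not> T \<Delta>' \<tturnstile> B"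
            using T[OF F] \<Delta>' AB \<open>B \<notin> \<Delta>'\<close> by auto
          moreover have "T \<Delta>' \<in> subtrees t"
            using F ds by (intro kid_in_subtrees) (auto simp: t_def)
          ultimately show False using forced by auto
        qed
      qed
    qed
  qed
  ultimately show ?case by blast
qed

theorem completeness:
  assumes "finite H" "\<And>t. persistent t \<Longrightarrow> \<forall>C\<in>H. t \<tturnstile> C \<Longrightarrow> t \<tturnstile> A"
  shows "H \<turnstile> A"
proof (rule ccontr)
  assume "\<not> H \<turnstile> A"
  let ?\<Sigma> = "subfms A \<union> (\<Union>C\<in>H. subfms C)"
  have \<Sigma>: "finite ?\<Sigma>" "sub_closed ?\<Sigma>"
    using assms(1) by (simp_all add: sub_closed_Un sub_closed_UN)
  have H: "H \<subseteq> ?\<Sigma>" by auto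
  obtain \<Delta> where \<Delta>: "prime_theory ?\<Sigma> \<Delta>" "H \<subseteq> \<Delta>" "\<not> \<Delta> \<turnstile> A"
    using prime_extension[OF \<Sigma> H \<open>\<not> H \<turnstile> A\<close>] by blast
  obtain t where "persistent t" and t: "\<forall>C\<in>?\<Sigma>. t \<tturnstile> C \<longleftrightarrow> C \<in> \<Delta>"
    using prime_theory_realised[OF \<Sigma> \<Delta>(1)] by blast
  moreover have "A \<notin> \<Delta>" using \<Delta>(3) Assm by blast
  ultimately show False
    using assms(2)[OF \<open>persistent t\<close>] \<Delta>(2) H self_in_subfms[of A] by blast
qed

lemma derivable_iff_forces: "{} \<turnstile> A \<longleftrightarrow> (\<forall>t. persistent t \<longrightarrow> t \<tturnstile> A)"
  using completeness[of "{}" A] soundness[of "{}" A] by blast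

lemma derivable1_iff_forces: "{B} \<turnstile> A \<longleftrightarrow> (\<forall>t. persistent t \<longrightarrow> t \<tturnstile> B \<longrightarrow> t \<tturnstile> A)"
  using completeness[of "{B}" A] soundness[of "{B}" A] by blast

lemma derivable_Imp_iff_forces:
  "{} \<turnstile> B \<^bold>\<longrightarrow> A \<longleftrightarrow> (\<forall>t. persistent t \<longrightarrow> t \<tturnstile> B \<longrightarrow> t \<tturnstile> A)"
  unfolding derivable_iff_forces using persistent_subtree by force

definition BigConj :: "'a fm set \<Rightarrow> 'a fm" where
  "BigConj S = foldr Conj (SOME xs. distinct xs \<and> set xs = S) (\<^bold>\<bottom> \<^bold>\<longrightarrow> \<^bold>\<bottom>)"

lemma some_list:
  assumes "finite S"
  shows "set (SOME xs. distinct xs \<and> set xs = S) = S"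
  using someI_ex[of "\<lambda>xs. distinct xs \<and> set xs = S"] finite_distinct_list[OF assms] by blast

lemma forces_BigDisj: "finite S \<Longrightarrow> t \<tturnstile> \<^bold>\<Or>S \<longleftrightarrow> (\<exists>C\<in>S. t \<tturnstile> C)"
proof -
  have "t \<tturnstile> foldr Disj xs \<^bold>\<bottom> \<longleftrightarrow> (\<exists>C\<in>set xs. t \<tturnstile> C)" for xs
    by (induction xs) auto
  then show "finite S \<Longrightarrow> ?thesis" by (simp add: BigDisj_def some_list)
qed

lemma forces_BigConj: "finite S \<Longrightarrow> t \<tturnstile> BigConj S \<longleftrightarrow> (\<forall>C\<in>S. t \<tturnstile> C)"
proof -
  have "t \<tturnstile> foldr Conj xs (\<^bold>\<bottom> \<^bold>\<longrightarrow> \<^bold>\<bottom>) \<longleftrightarrow> (\<forall>C\<in>set xs. t \<tturnstile> C)" for xs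
    by (induction xs) auto
  then show "finite S \<Longrightarrow> ?thesis" by (simp add: BigConj_def some_list)
qed

lemma BigDisj_lang: "finite S \<Longrightarrow> S \<subseteq> lang X \<Longrightarrow> \<^bold>\<Or>S \<in> lang X"
proof -
  have "set xs \<subseteq> lang X \<Longrightarrow> foldr Disj xs \<^bold>\<bottom> \<in> lang X" for xs
    by (induction xs) auto
  then show "finite S \<Longrightarrow> S \<subseteq> lang X \<Longrightarrow> ?thesis" by (simp add: BigDisj_def some_list)
qed

lemma BigConj_lang: "finite S \<Longrightarrow> S \<subseteq> lang X \<Longrightarrow> BigConj S \<in> lang X"
proof -
  have "set xs \<subseteq> lang X \<Longrightarrow> foldr Conj xs (\<^bold>\<bottom> \<^bold>\<longrightarrow> \<^bold>\<bottom>) \<in> lang X" for xs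
    by (induction xs) auto
  then show "finite S \<Longrightarrow> S \<subseteq> lang X \<Longrightarrow> ?thesis" by (simp add: BigConj_def some_list)
qed

section \<open>Substitutions acting on models\<close>

primrec subst :: "('a \<Rightarrow> 'a fm) \<Rightarrow> 'a fm \<Rightarrow> 'a fm" where
  "subst f (Atom a) = f a"
| "subst f \<^bold>\<bottom> = \<^bold>\<bottom>"
| "subst f (A \<^bold>\<and> B) = subst f A \<^bold>\<and> subst f B"
| "subst f (A \<^bold>\<or> B) = subst f A \<^bold>\<or> subst f B"
| "subst f (A \<^bold>\<longrightarrow> B) = subst f A \<^bold>\<longrightarrow> subst f B"

text \<open>The action of a substitution on models, dual to that on formulas by
  \<open>forces_pull\<close>. Duality reverses composition in \<open>pull_pull\<close>.\<close>

fun pull :: "('a \<Rightarrow> 'a fm) \<Rightarrow> 'a tree \<Rightarrow> 'a tree" where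
  "pull f (Node V ts) = Node {a. Node V ts \<tturnstile> f a} (map (pull f) ts)"

lemma root_pull: "root (pull f t) = {a. t \<tturnstile> f a}"
  by (cases t) auto

lemma kids_pull: "kids (pull f t) = map (pull f) (kids t)"
  by (cases t) auto

lemma subtrees_pull: "subtrees (pull f t) = pull f ` subtrees t"
  by (induction t) auto

lemma forces_pull: "pull f t \<tturnstile> A \<longleftrightarrow> t \<tturnstile> subst f A"
  by (induction A arbitrary: t) (auto simp: root_pull subtrees_pull)

lemma persistent_pull: "persistent t \<Longrightarrow> persistent (pull f t)"
proof (induction t)
  case (Node V ts)
  have "{a. Node V ts \<tturnstile> f a} \<subseteq> root (pull f s)" if "s \<in> set ts" for s
    using forces_subtree[OF _ Node.prems kid_in_subtrees] that by (auto simp: root_pull)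
  then show ?case using Node by auto
qed

lemma pull_Atom: "pull Atom t = t"
  by (induction t) (auto intro: map_idI)

lemma pull_pull: "pull f (pull g t) = pull (\<lambda>a. subst g (f a)) t"
proof (induction t)
  case (Node V ts)
  have "{a. pull g (Node V ts) \<tturnstile> f a} = {a. Node V ts \<tturnstile> subst g (f a)}"
    using forces_pull by blast
  then show ?case using Node by auto
qed

lemma subst_id: "(\<And>a. a \<in> S \<Longrightarrow> f a = Atom a) \<Longrightarrow> A \<in> lang S \<Longrightarrow> subst f A = A"
  by (induction A) auto

lemma subst_lang: "(\<And>a. a \<in> S \<Longrightarrow> f a \<in> lang T) \<Longrightarrow> A \<in> lang S \<Longrightarrow> subst f A \<in> lang T"
  by (induction A) auto

lemma substitution_subst:
  assumes "\<And>a. a \<in> var \<union> par \<Longrightarrow> f a \<in> lang (var \<union> par)" "\<And>p. p \<in> par \<Longrightarrow> f p = Atom p"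
  shows "substitution var par (subst f)"
  using assms subst_lang[of "var \<union> par" f] by (auto simp: substitution_def)

lemma substitution_eq_subst:
  assumes "substitution var par \<theta>" "A \<in> lang (var \<union> par)"
  shows "\<theta> A = subst (\<lambda>a. \<theta> (Atom a)) A"
  using assms(2) assms(1) by (induction A) (auto simp: substitution_def)

section \<open>Types and formulas restricting them\<close>

definition type_of :: "'a fm set \<Rightarrow> 'a tree \<Rightarrow> 'a fm set" where
  "type_of \<Sigma> t = {C \<in> \<Sigma>. t \<tturnstile> C}"

text \<open>No bounded bisimulation is needed: an implication holds at the root iff it holds
  locally there and at all immediate successors, so the types of the successors suffice.\<close>

lemma type_of_Node_cong:
  assumes "sub_closed \<Sigma>" "\<And>a. Atom a \<in> \<Sigma> \<Longrightarrow> a \<in> V \<longleftrightarrow> a \<in> V'"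
    and "type_of \<Sigma> ` set ts = type_of \<Sigma> ` set ts'"
  shows "type_of \<Sigma> (Node V ts) = type_of \<Sigma> (Node V' ts')"
proof -
  have kids: "(\<forall>s\<in>set ts. s \<tturnstile> C) \<longleftrightarrow> (\<forall>s\<in>set ts'. s \<tturnstile> C)" if "C \<in> \<Sigma>" for C
  proof -
    have "(\<forall>s\<in>set us. s \<tturnstile> C) \<longleftrightarrow> (\<forall>T \<in> type_of \<Sigma> ` set us. C \<in> T)" for us
      using that by (auto simp: type_of_def)
    then show ?thesis using assms(3) by metis
  qed
  have "Node V ts \<tturnstile> C \<longleftrightarrow> Node V' ts' \<tturnstile> C" if "C \<in> \<Sigma>" for C
    using that
  proof (induction C)
    case (Imp A B)
    then show ?case
      unfolding forces_Imp_Node using kids sub_closedD[OF assms(1)] by blast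
  qed (auto simp: assms(2) dest: sub_closedD[OF assms(1)])
  then show ?thesis by (auto simp: type_of_def)
qed

text \<open>A node that forces all of \<open>T\<close> and nothing in \<open>\<Sigma> - T\<close>
  has type \<open>T\<close>; each implication therefore excludes one type outside
  \<open>\<T>\<close> from all nodes.\<close>

definition types_within :: "'a fm set \<Rightarrow> 'a fm set set \<Rightarrow> 'a fm" where
  "types_within \<Sigma> \<T> =
     BigConj ((\<lambda>T. BigConj T \<^bold>\<longrightarrow> \<^bold>\<Or>(\<Sigma> - T)) ` (Pow \<Sigma> - \<T>))"

lemma forces_types_within:
  assumes "finite \<Sigma>"
  shows "t \<tturnstile> types_within \<Sigma> \<T> \<longleftrightarrow> (\<forall>s\<in>subtrees t. type_of \<Sigma> s \<in> \<T>)"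
proof -
  have eq: "(s \<tturnstile> BigConj T \<longrightarrow> s \<tturnstile> \<^bold>\<Or>(\<Sigma> - T)) \<longleftrightarrow> type_of \<Sigma> s \<noteq> T" if "T \<subseteq> \<Sigma>" for s T
  proof -
    have "finite T" "finite (\<Sigma> - T)" using that assms finite_subset by auto
    then show ?thesis using that by (auto simp: forces_BigConj forces_BigDisj type_of_def)
  qed
  have "t \<tturnstile> types_within \<Sigma> \<T> \<longleftrightarrow>
      (\<forall>T\<in>Pow \<Sigma> - \<T>. \<forall>s\<in>subtrees t. s \<tturnstile> BigConj T \<longrightarrow> s \<tturnstile> \<^bold>\<Or>(\<Sigma> - T))"
    using assms by (auto simp: types_within_def forces_BigConj)
  also have "\<dots> \<longleftrightarrow> (\<forall>T\<in>Pow \<Sigma> - \<T>. \<forall>s\<in>subtrees t. type_of \<Sigma> s \<noteq> T)"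
    by (simp add: eq)
  also have "\<dots> \<longleftrightarrow> (\<forall>s\<in>subtrees t. type_of \<Sigma> s \<in> \<T>)"
    by (auto simp: type_of_def)
  finally show ?thesis .
qed

lemma types_within_lang:
  assumes "finite \<Sigma>" "\<Sigma> \<subseteq> lang X"
  shows "types_within \<Sigma> \<T> \<in> lang X"
proof -
  have "BigConj T \<^bold>\<longrightarrow> \<^bold>\<Or>(\<Sigma> - T) \<in> lang X" if "T \<subseteq> \<Sigma>" for T
    using that assms finite_subset[of T \<Sigma>] BigConj_lang[of T X] BigDisj_lang[of "\<Sigma> - T" X]
    by auto
  then show ?thesis
    unfolding types_within_def using assms(1) by (intro BigConj_lang) auto
qed

section \<open>Projectivity from the extension property\<close>

text \<open>\<open>extend\<close> is the extension property relative to \<open>E\<close>: the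
  parameters of the new root are prescribed, and only variables may be revalued.\<close>

locale extendable =
  fixes var par :: "'a set" and E B :: "'a fm"
  assumes disjoint: "var \<inter> par = {}"
    and finite_var: "finite var" and finite_par: "finite par"
    and E_lang: "E \<in> lang par" and B_lang: "B \<in> lang (var \<union> par)"
    and B_imp_E: "\<And>t. persistent t \<Longrightarrow> t \<tturnstile> B \<Longrightarrow> t \<tturnstile> E"
    and extend: "\<And>V ts. persistent (Node V ts) \<Longrightarrow> Node V ts \<tturnstile> E \<Longrightarrow> \<forall>s\<in>set ts. s \<tturnstile> B \<Longrightarrow>
      \<exists>X\<subseteq>var. persistent (Node ((V - var) \<union> X) ts) \<and> Node ((V - var) \<union> X) ts \<tturnstile> B"
begin

text \<open>Given \<open>B\<close>, either value is equivalent to the atom. Where \<open>B\<close>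
  fails, the conjunction makes a variable false, while the implication makes it as true as the nodes
  above that force \<open>B\<close> permit.\<close>

definition step :: "'a set \<Rightarrow> 'a \<Rightarrow> 'a fm" where
  "step X a = (if a \<notin> var then Atom a else if a \<in> X then B \<^bold>\<longrightarrow> Atom a else B \<^bold>\<and> Atom a)"

definition run :: "'a set list \<Rightarrow> 'a tree \<Rightarrow> 'a tree" where
  "run Xs = fold (\<lambda>X. pull (step X)) Xs"

lemma run_simps [simp]:
  "run [] t = t" "run (X # Xs) t = run Xs (pull (step X) t)" "run (Xs @ Ys) t = run Ys (run Xs t)"
  by (simp_all add: run_def)

text \<open>A whole run is one substitution into the language, so the repair argument can work with
  trees alone and still yield a syntactic witness.\<close>

lemma run_eq_pull:
  "\<exists>f. run Xs = pull f \<and> (\<forall>a. a \<notin> var \<longrightarrow> f a = Atom a) \<and>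
     (\<forall>a\<in>var. f a \<in> lang (var \<union> par))"
proof (induction Xs)
  case Nil
  show ?case by (rule exI[of _ Atom]) (auto simp: fun_eq_iff pull_Atom)
next
  case (Cons X Xs)
  then obtain f where f: "run Xs = pull f" "\<forall>a. a \<notin> var \<longrightarrow> f a = Atom a"
    "\<forall>a\<in>var. f a \<in> lang (var \<union> par)" by blast
  have "step X a \<in> lang (var \<union> par)" if "a \<in> var \<union> par" for a
    using that B_lang by (auto simp: step_def)
  then have "subst (step X) (f a) \<in> lang (var \<union> par)" if "a \<in> var" for a
    using f(3) that subst_lang by blast
  moreover have "run (X # Xs) = pull (\<lambda>a. subst (step X) (f a))"
    by (simp add: fun_eq_iff f(1) pull_pull)
  ultimately show ?case
    using f(2) by (intro exI[of _ "\<lambda>a. subst (step X) (f a)"]) (auto simp: step_def)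
qed

lemma kids_run: "kids (run Xs t) = map (run Xs) (kids t)"
  using run_eq_pull[of Xs] kids_pull by metis

lemma subtrees_run: "subtrees (run Xs t) = run Xs ` subtrees t"
  using run_eq_pull[of Xs] subtrees_pull by metis

lemma persistent_run: "persistent t \<Longrightarrow> persistent (run Xs t)"
  using run_eq_pull[of Xs] persistent_pull by metis

lemma root_run: "root (run Xs t) - var = root t - var"
proof -
  obtain f where "run Xs = pull f" "\<forall>a. a \<notin> var \<longrightarrow> f a = Atom a"
    using run_eq_pull by blast
  then show ?thesis by (auto simp: root_pull)
qed

lemma run_forces_E: "run Xs t \<tturnstile> E \<longleftrightarrow> t \<tturnstile> E"
proof -
  obtain f where f: "run Xs = pull f" "\<forall>a. a \<notin> var \<longrightarrow> f a = Atom a"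
    using run_eq_pull by blast
  have "subst f E = E" using f(2) disjoint E_lang by (intro subst_id[of par]) auto
  then show ?thesis by (simp add: f(1) forces_pull)
qed

lemma pull_step_id: "persistent t \<Longrightarrow> t \<tturnstile> B \<Longrightarrow> pull (step X) t = t"
proof (induction t)
  case (Node V ts)
  have "pull (step X) s = s" if "s \<in> set ts" for s
    using Node that forces_subtree[OF Node.prems(2,1) kid_in_subtrees] by auto
  moreover have "Node V ts \<tturnstile> step X a \<longleftrightarrow> a \<in> V" for a
  proof -
    have "V \<subseteq> root s" if "s \<in> subtrees (Node V ts)" for s
      using persistent_subtree[OF that Node.prems(1)] by simp
    then have "Node V ts \<tturnstile> B \<^bold>\<longrightarrow> Atom a \<longleftrightarrow> a \<in> V"
      using Node.prems(2) unfolding forces.simps by (metis self_in_subtrees subsetD tree.sel(1))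
    then show ?thesis using Node.prems(2) unfolding step_def by simp
  qed
  ultimately show ?case by (simp add: map_idI)
qed

lemma run_id: "persistent t \<Longrightarrow> t \<tturnstile> B \<Longrightarrow> run Xs t = t"
  by (induction Xs) (simp_all add: pull_step_id)

lemma run_forces_B: "persistent t \<Longrightarrow> t \<tturnstile> B \<Longrightarrow> run Xs t \<tturnstile> B"
  by (simp add: run_id)

text \<open>Nodes forcing \<open>B\<close> survive a run unchanged, so it can only add to them, and
  \<open>B \<longrightarrow> C\<close> speaks of these nodes alone.\<close>

lemma run_antimono:
  assumes "persistent t" "run Xs t \<tturnstile> B \<^bold>\<longrightarrow> C"
  shows "t \<tturnstile> B \<^bold>\<longrightarrow> C"
proof -
  have "s \<tturnstile> C" if s: "s \<in> subtrees t" "s \<tturnstile> B" for s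
  proof -
    have "run Xs s = s" using run_id persistent_subtree assms(1) s by blast
    then have "s \<in> subtrees (run Xs t)" using s(1) subtrees_run by (metis imageI)
    then show ?thesis using assms(2) s(2) by simp
  qed
  then show ?thesis by simp
qed

text \<open>The successors never change, as they force \<open>B\<close>. When the step for the right
  set \<open>X\<close> is reached, the node is either repaired already or receives the valuation
  given by \<open>extend\<close>; later steps leave it alone.\<close>

lemma frontier:
  assumes "persistent t" "t \<tturnstile> E" "\<forall>s\<in>set (kids t). s \<tturnstile> B" "Pow var \<subseteq> set Xs"
  shows "run Xs t \<tturnstile> B"
proof -
  obtain V ts where t: "t = Node V ts" by (cases t)
  obtain X where X: "X \<subseteq> var" "persistent (Node ((V - var) \<union> X) ts)"
      "Node ((V - var) \<union> X) ts \<tturnstile> B"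
    using extend[of V ts] assms(1-3) t by auto
  obtain Ys Zs where Xs: "Xs = Ys @ X # Zs"
    using X(1) assms(4) by (meson PowI split_list subsetD)
  let ?u = "run Ys t"
  have u: "persistent ?u" using persistent_run assms(1) by blast
  have kid: "persistent s" "s \<tturnstile> B" if "s \<in> set ts" for s
    using assms(1,3) that t by auto
  have "kids ?u = ts" using kids_run[of Ys t] kid by (simp add: t map_idI run_id)
  then obtain W where W: "?u = Node W ts" by (metis tree.exhaust_sel)
  have W_V: "W - var = V - var" using root_run[of Ys t] W t by simp
  have "pull (step X) ?u \<tturnstile> B"
  proof (cases "?u \<tturnstile> B")
    case True
    then show ?thesis using pull_step_id u by simp
  next
    case False
    \<comment> \<open>As \<open>?u\<close> does not force \<open>B\<close>,
      \<open>B \<and> a\<close> fails there, and \<open>B \<longrightarrow> a\<close> depends on the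
      successors only, whose roots all contain \<open>X\<close> by persistence.\<close>
    have "?u \<tturnstile> step X a \<longleftrightarrow> a \<in> (V - var) \<union> X" for a
    proof (cases "a \<in> var")
      case True
      have "?u \<tturnstile> B \<^bold>\<longrightarrow> Atom a" if "a \<in> X"
      proof -
        have "s \<tturnstile> B \<^bold>\<longrightarrow> Atom a" if "s \<in> set ts" for s
          using X(2) \<open>a \<in> X\<close> that kid(1)[OF that] persistent_subtree by fastforce
        then show ?thesis using False unfolding W forces_Imp_Node by blast
      qed
      then show ?thesis using True False by (auto simp: step_def)
    next
      case False
      then show ?thesis using W_V X(1) W by (auto simp: step_def)
    qed
    moreover have "map (pull (step X)) ts = ts" using kid by (intro map_idI pull_step_id)
    ultimately have "pull (step X) ?u = Node ((V - var) \<union> X) ts" using W by auto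
    then show ?thesis using X(3) by simp
  qed
  then have "run Zs (pull (step X) ?u) \<tturnstile> B"
    using run_forces_B persistent_pull u by blast
  then show ?thesis by (simp add: Xs)
qed

section \<open>Passes and the bound on their number\<close>

definition subsets :: "'a set list" where
  "subsets = (SOME Xs. set Xs = Pow var)"

lemma set_subsets: "set subsets = Pow var"
  unfolding subsets_def by (rule someI_ex) (simp add: finite_list finite_var)

text \<open>\<open>var\<close> occurs in \<open>subsets\<close> too, but is applied once more at the
  end, so that \<open>B \<longrightarrow> a\<close> refers to the topmost failing nodes after their
  repair.\<close>

definition pass :: "'a set list" where
  "pass = subsets @ [var]"

definition stage :: "nat \<Rightarrow> 'a set list" where
  "stage n = concat (replicate n pass)"

lemma stage_simps [simp]: "stage 0 = []" "stage (Suc n) = stage n @ pass"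
proof -
  have "concat (replicate n pass) @ pass = pass @ concat (replicate n pass)"
    by (induction n) simp_all
  then show "stage (Suc n) = stage n @ pass" by (simp add: stage_def)
qed (simp add: stage_def)

lemma stage_add: "stage (m + n) = stage m @ stage n"
  by (simp add: stage_def replicate_add)

text \<open>A node that forces \<open>B\<close> is left unchanged by all later steps, so the condition for a given
  \<open>n\<close> only gets stronger as \<open>n\<close> grows.\<close>

definition limit :: "'a tree \<Rightarrow> 'a fm set" where
  "limit t = {C \<in> subfms B. \<forall>n. run (stage n) t \<tturnstile> B \<^bold>\<longrightarrow> C}"

text \<open>Both summands can only shrink on the way up, and their bounds do not depend on the tree.
  As \<open>limit\<close> looks at all stages at once, the passes do not alter this measure of the
  original tree.\<close>

definition deficit :: "'a tree \<Rightarrow> nat" where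
  "deficit t = card (subfms B - limit t) + card (par - root t)"

lemma limit_mono:
  assumes "persistent t" "s \<in> subtrees t"
  shows "limit t \<subseteq> limit s"
proof -
  have "run (stage n) s \<tturnstile> B \<^bold>\<longrightarrow> C" if "run (stage n) t \<tturnstile> B \<^bold>\<longrightarrow> C" for n C
    using forces_subtree[OF that persistent_run[OF assms(1)]] assms(2) subtrees_run by blast
  then show ?thesis by (auto simp: limit_def)
qed

text \<open>From stage \<open>n\<close> on the tree is frozen, and where \<open>B\<close> is forced,
  \<open>B \<longrightarrow> C\<close> and \<open>C\<close> agree. Earlier stages follow by
  \<open>run_antimono\<close>.\<close>

lemma limit_eq_type:
  assumes "persistent t" "run (stage n) t \<tturnstile> B"
  shows "limit t = type_of (subfms B) (run (stage n) t)"
proof -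
  have later: "run (stage m) t = run (stage n) t" if "n \<le> m" for m
  proof -
    have "stage m = stage n @ stage (m - n)" using that stage_add[of n "m - n"] by simp
    then show ?thesis using run_id persistent_run assms by simp
  qed
  have "(\<forall>m. run (stage m) t \<tturnstile> B \<^bold>\<longrightarrow> C) \<longleftrightarrow> run (stage n) t \<tturnstile> C" for C
  proof
    assume "\<forall>m. run (stage m) t \<tturnstile> B \<^bold>\<longrightarrow> C"
    then have "run (stage n) t \<tturnstile> B \<^bold>\<longrightarrow> C" by blast
    then show "run (stage n) t \<tturnstile> C" using assms(2) by auto
  next
    assume C: "run (stage n) t \<tturnstile> C"
    have n: "run (stage n) t \<tturnstile> B \<^bold>\<longrightarrow> C"
      using forces_subtree[OF C persistent_run[OF assms(1)]] by simp
    show "\<forall>m. run (stage m) t \<tturnstile> B \<^bold>\<longrightarrow> C"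
    proof
      fix m
      show "run (stage m) t \<tturnstile> B \<^bold>\<longrightarrow> C"
      proof (cases "n \<le> m")
        case True
        show ?thesis unfolding later[OF True] by (rule n)
      next
        case False
        then have "stage n = stage m @ stage (n - m)" using stage_add[of m "n - m"] by simp
        then have "run (stage n) t = run (stage (n - m)) (run (stage m) t)" by simp
        then show ?thesis using n run_antimono persistent_run[OF assms(1)] by metis
      qed
    qed
  qed
  then show ?thesis by (auto simp: limit_def type_of_def)
qed

text \<open>Nodes of smaller deficit force \<open>B\<close> already. The remaining nodes above \<open>t\<close> share
  one limit and one set of parameters; the topmost of them realise the limit \<open>J\<close> as their
  type after one run through \<open>subsets\<close>, and the final step \<open>var\<close> gives this type to all others.\<close>

lemma stage_step:
  assumes IH: "\<And>s. persistent s \<Longrightarrow> s \<tturnstile> E \<Longrightarrow> deficit s < m \<Longrightarrow> run (stage m) s \<tturnstile> B"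
    and t: "persistent t" "t \<tturnstile> E" "deficit t \<le> m"
  shows "run (stage (Suc m)) t \<tturnstile> B"
proof -
  let ?w = "run (stage m)" and ?u = "run (stage m @ subsets)" and ?z = "run (stage (Suc m))"
  let ?\<Sigma> = "subfms B"
  define J where "J = limit t"
  define X where "X = {s \<in> subtrees t. \<not> ?w s \<tturnstile> B}"
  have z: "?z s = run [var] (?u s)" for s by (simp add: pass_def)
  have sub: "persistent s" "s \<tturnstile> E" if "s \<in> subtrees t" for s
    using that t(1,2) persistent_subtree forces_subtree by blast+
  have X_sub: "s' \<in> X" if "s' \<in> subtrees s" "s \<in> subtrees t" "\<not> ?w s' \<tturnstile> B" for s s'
    using that subtrees_trans by (auto simp: X_def)
  \<comment> \<open>By \<open>IH\<close>, a node unrepaired after \<open>m\<close> passes has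
    deficit at least \<open>m\<close>, hence at least that of \<open>t\<close>. Neither summand
    grows upwards, so both equal those of \<open>t\<close>.\<close>
  have X_limit: "limit s = J \<and> par \<inter> root s = par \<inter> root t" if "s \<in> X" for s
  proof -
    have s: "s \<in> subtrees t" "\<not> ?w s \<tturnstile> B" using that by (auto simp: X_def)
    have le: "?\<Sigma> - limit s \<subseteq> ?\<Sigma> - J" "par - root s \<subseteq> par - root t"
      using limit_mono[OF t(1) s(1)] persistent_subtree[OF s(1) t(1)] by (auto simp: J_def)
    have "deficit t \<le> deficit s" using IH[OF sub[OF s(1)]] s(2) t(3) by force
    moreover have "card (?\<Sigma> - limit s) \<le> card (?\<Sigma> - J)" "card (par - root s) \<le> card (par - root t)"
      using le finite_par by (simp_all add: card_mono)
    ultimately have "card (?\<Sigma> - limit s) = card (?\<Sigma> - J)" "card (par - root s) = card (par - root t)"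
      by (simp_all add: deficit_def J_def)
    then have "?\<Sigma> - limit s = ?\<Sigma> - J" "par - root s = par - root t"
      using le finite_par by (simp_all add: card_subset_eq)
    moreover have "limit s \<subseteq> ?\<Sigma>" "J \<subseteq> ?\<Sigma>" by (auto simp only: limit_def J_def)
    ultimately show ?thesis by blast
  qed
  \<comment> \<open>\<open>frontier\<close> repairs a topmost failing node \<open>d\<close> above
    \<open>s\<close>. It is frozen from then on, so its type is its limit \<open>J\<close>.\<close>
  have witness: "\<exists>d\<in>subtrees s \<inter> X. ?u d \<tturnstile> B \<and> J = type_of ?\<Sigma> (?u d)" if "s \<in> X" for s
  proof -
    have s: "s \<in> subtrees t" using that by (auto simp: X_def)
    obtain d where d: "d \<in> subtrees s" "\<not> ?w d \<tturnstile> B" "\<forall>c\<in>set (kids d). ?w c \<tturnstile> B"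
      using minimal_failure[of "\<lambda>s. ?w s \<tturnstile> B" s] \<open>s \<in> X\<close> by (auto simp: X_def)
    have dX: "d \<in> X" using X_sub d s by blast
    then have dt: "persistent d" "d \<tturnstile> E" using sub by (auto simp: X_def)
    have "run subsets (?w d) \<tturnstile> B"
    proof (rule frontier)
      show "persistent (?w d)" using persistent_run dt by blast
      show "?w d \<tturnstile> E" using run_forces_E dt by blast
      show "\<forall>s\<in>set (kids (?w d)). s \<tturnstile> B" using d(3) by (simp add: kids_run)
    qed (simp add: set_subsets)
    then have ud: "?u d \<tturnstile> B" by simp
    then have "?z d = ?u d" unfolding z using run_id persistent_run dt(1) by blast
    then have "J = type_of ?\<Sigma> (?u d)"
      using limit_eq_type[of d "Suc m"] ud dt(1) X_limit[OF dX] by metis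
    then show ?thesis using d(1) dX ud by blast
  qed
  \<comment> \<open>For \<open>C \<in> J\<close>, the limit gives
    \<open>B \<longrightarrow> C\<close> after the full pass, and \<open>run_antimono\<close>
    carries it back before the step \<open>var\<close>. Conversely, the witness above
    \<open>s\<close> forces \<open>B\<close> and has type \<open>J\<close>.\<close>
  have u_iff: "?u s \<tturnstile> B \<^bold>\<longrightarrow> C \<longleftrightarrow> C \<in> J" if sX: "s \<in> X" and C\<Sigma>: "C \<in> ?\<Sigma>" for s C
  proof
    assume "C \<in> J"
    then have "?z s \<tturnstile> B \<^bold>\<longrightarrow> C" using X_limit[OF sX] unfolding limit_def by blast
    moreover have "persistent (?u s)" using persistent_run sub sX unfolding X_def by blast
    ultimately show "?u s \<tturnstile> B \<^bold>\<longrightarrow> C" unfolding z using run_antimono by blast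
  next
    assume C: "?u s \<tturnstile> B \<^bold>\<longrightarrow> C"
    obtain d where d: "d \<in> subtrees s" "?u d \<tturnstile> B" "J = type_of ?\<Sigma> (?u d)"
      using witness[OF sX] by blast
    then have "?u d \<in> subtrees (?u s)" using subtrees_run by blast
    then show "C \<in> J" using C d C\<Sigma> by (simp add: type_of_def)
  qed
  show ?thesis
  proof (cases "t \<in> X \<and> \<not> ?u t \<tturnstile> B")
    case False
    then have "?u t \<tturnstile> B"
      using run_forces_B[of "?w t" subsets] persistent_run t(1) by (auto simp: X_def)
    then show ?thesis unfolding z using run_forces_B persistent_run t(1) by blast
  next
    case True
    then obtain d where d: "d \<in> X" "?u d \<tturnstile> B" "J = type_of ?\<Sigma> (?u d)"
      using witness by blast
    \<comment> \<open>By \<open>u_iff\<close>, \<open>J\<close> collects what such a node forces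
      conditionally on \<open>B\<close>; the step \<open>var\<close> makes it the actual type. Since
      \<open>B \<in> J\<close>, this repairs \<open>t\<close>.\<close>
    have "\<forall>C\<in>?\<Sigma>. ?z s \<tturnstile> C \<longleftrightarrow> C \<in> J" if "s \<in> X" "\<not> ?u s \<tturnstile> B" for s
      using that
    proof (induction s)
      case (Node V ts)
      let ?s = "Node V ts"
      have "?s \<in> subtrees t" using Node.prems(1) unfolding X_def by blast
      then have ps: "persistent ?s" "?s \<in> subtrees t" using sub(1) by blast+
      have into_J: "C \<in> J" if "C \<in> ?\<Sigma>" "?z ?s \<tturnstile> C" for C
      proof -
        have "?z ?s \<tturnstile> B \<^bold>\<longrightarrow> C"
          using forces_subtree[OF that(2) persistent_run[OF ps(1)]] by simp
        then have "?u ?s \<tturnstile> B \<^bold>\<longrightarrow> C"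
          unfolding z using run_antimono persistent_run ps(1) by blast
        then show ?thesis using u_iff Node.prems(1) that(1) by blast
      qed
      have from_J: "?z ?s \<tturnstile> C" if "C \<in> ?\<Sigma>" "C \<in> J" for C
        using that
      proof (induction C)
        case (Atom a)
        \<comment> \<open>A variable becomes \<open>B \<longrightarrow> a\<close>, which
          \<open>u_iff\<close> decides. Parameters are untouched by runs and shared by all nodes of
          \<open>X\<close>, including \<open>d\<close>.\<close>
        have "?u ?s \<tturnstile> step var a"
        proof (cases "a \<in> var")
          case True
          then show ?thesis using u_iff[OF Node.prems(1) Atom.prems(1)] Atom.prems(2)
            by (simp add: step_def)
        next
          case False
          then have a: "a \<in> par" using Atom.prems(1) subfms_lang[OF B_lang] by auto
          have "a \<in> root (?u d)" using Atom.prems d(3) by (simp add: type_of_def)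
          then have "a \<in> root d" using root_run False by (metis DiffD1 DiffI)
          then have "a \<in> root ?s" using X_limit d(1) Node.prems(1) a by blast
          then have "a \<in> root (?u ?s)" using root_run False by (metis DiffD1 DiffI)
          then show ?thesis using False by (simp add: step_def)
        qed
        then show ?case unfolding z by (simp add: root_pull)
      next
        case (Imp C D)
        then have CD: "C \<in> ?\<Sigma>" "D \<in> ?\<Sigma>" using sub_closedD sub_closed_subfms by blast+
        \<comment> \<open>\<open>J\<close> is closed under modus ponens in \<open>?\<Sigma>\<close>,
          being the type of the actual node \<open>?u d\<close>.\<close>
        have "?z ?s \<tturnstile> C \<longrightarrow> ?z ?s \<tturnstile> D"
        proof
          assume "?z ?s \<tturnstile> C"
          then have "C \<in> J" using into_J CD by blast
          then have "D \<in> J" using Imp.prems(2) d(3) CD by (auto simp: type_of_def)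
          then show "?z ?s \<tturnstile> D" using Imp.IH CD by blast
        qed
        \<comment> \<open>A successor forcing \<open>B\<close> before the last step gets
          \<open>C \<longrightarrow> D\<close> from \<open>u_iff\<close> at \<open>?s\<close>; any
          other has type \<open>J\<close> by the tree induction.\<close>
        moreover have "?z c \<tturnstile> C \<^bold>\<longrightarrow> D" if "c \<in> set ts" for c
        proof -
          have c: "c \<in> subtrees ?s" using that kid_in_subtrees[of c ?s] by simp
          have pc: "persistent c" using c ps(1) persistent_subtree by blast
          show ?thesis
          proof (cases "?u c \<tturnstile> B")
            case True
            have "?u ?s \<tturnstile> B \<^bold>\<longrightarrow> (C \<^bold>\<longrightarrow> D)" using u_iff Node.prems(1) Imp.prems by blast
            moreover have "?u c \<in> subtrees (?u ?s)" using c subtrees_run by blast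
            ultimately have "?u c \<tturnstile> C \<^bold>\<longrightarrow> D" using True forces.simps(5) by blast
            moreover have "?z c = ?u c" unfolding z using run_id persistent_run pc True by blast
            ultimately show ?thesis by simp
          next
            case False
            then have "\<not> ?w c \<tturnstile> B"
              using run_forces_B[of "?w c" subsets] persistent_run pc by auto
            then have "c \<in> X" using X_sub c ps(2) by blast
            then show ?thesis using Node.IH[OF that _ False] Imp.prems by blast
          qed
        qed
        moreover obtain W where W: "?z ?s = Node W (map ?z ts)"
          using kids_run[of "stage (Suc m)" ?s] by (metis tree.collapse tree.sel(2))
        ultimately show ?case unfolding W forces_Imp_Node by auto
      qed (auto simp: d(3) type_of_def dest: sub_closedD[OF sub_closed_subfms])
      show ?case using into_J from_J by blast
    qed
    then have "?z t \<tturnstile> B \<longleftrightarrow> B \<in> J" using True by simp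
    moreover have "B \<in> J" using d(2,3) by (simp add: type_of_def)
    ultimately show ?thesis by simp
  qed
qed

lemma stage_forces:
  "persistent t \<Longrightarrow> t \<tturnstile> E \<Longrightarrow> deficit t < m \<Longrightarrow> run (stage m) t \<tturnstile> B"
proof (induction m arbitrary: t)
  case (Suc m)
  show ?case using Suc.prems by (intro stage_step Suc.IH) auto
qed simp

theorem projective: "projective var par E B"
proof -
  \<comment> \<open>\<open>N\<close> exceeds every possible deficit, so one number of passes, hence
    one substitution, serves all trees.\<close>
  define N where "N = Suc (card (subfms B) + card par)"
  obtain f where f: "run (stage N) = pull f" "\<forall>a. a \<notin> var \<longrightarrow> f a = Atom a"
    "\<forall>a\<in>var. f a \<in> lang (var \<union> par)"
    using run_eq_pull by blast
  have sub: "substitution var par (subst f)"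
    using f disjoint by (intro substitution_subst) auto
  have fixed: "t \<tturnstile> f a \<longleftrightarrow> a \<in> root t" if "persistent t" "t \<tturnstile> B" for t a
    using run_id[OF that, of "stage N"] by (metis f(1) mem_Collect_eq root_pull)
  have "{B} \<turnstile> subst f (Atom a) \<^bold>\<longleftrightarrow> Atom a" for a
    unfolding derivable1_iff_forces
  proof (intro allI impI)
    fix t assume t: "persistent t" "t \<tturnstile> B"
    have "s \<tturnstile> f a \<longleftrightarrow> a \<in> root s" if "s \<in> subtrees t" for s
      using fixed persistent_subtree[OF that t(1)] forces_subtree[OF t(2,1) that] by blast
    then show "t \<tturnstile> subst f (Atom a) \<^bold>\<longleftrightarrow> Atom a" by (simp add: Iff_def)
  qed
  moreover have "t \<tturnstile> subst f B \<longleftrightarrow> t \<tturnstile> E" if t: "persistent t" for t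
  proof
    assume "t \<tturnstile> subst f B"
    then have "run (stage N) t \<tturnstile> B" by (simp add: f(1) forces_pull)
    then show "t \<tturnstile> E" using B_imp_E persistent_run t run_forces_E by blast
  next
    assume "t \<tturnstile> E"
    moreover have "deficit t < N"
      unfolding deficit_def N_def using finite_par
      by (simp add: add_mono card_mono less_Suc_eq_le)
    ultimately have "run (stage N) t \<tturnstile> B" using stage_forces t by blast
    then show "t \<tturnstile> subst f B" by (simp add: f(1) forces_pull)
  qed
  then have "{} \<turnstile> subst f B \<^bold>\<longleftrightarrow> E"
    unfolding derivable_iff_forces Iff_def using persistent_subtree by simp blast
  ultimately show ?thesis
    unfolding projective_def using B_lang sub by blast
qed

end

section \<open>Projective approximations\<close>

definition realised_types :: "'a fm \<Rightarrow> ('a \<Rightarrow> 'a fm) \<Rightarrow> 'a fm set \<Rightarrow> 'a fm set set" where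
  "realised_types E f \<Sigma> = {type_of \<Sigma> (pull f t) | t. persistent t \<and> t \<tturnstile> E}"

text \<open>The successors have the types of \<open>f\<close>-images of models \<open>R s\<close> of
  \<open>E\<close>. Gluing these models gives a model \<open>r\<close> of \<open>E\<close>, whose
  image dictates the variables \<open>X\<close> at the root and so realises the root's type.\<close>

lemma realised_types_extendable:
  assumes "var \<inter> par = {}" "finite var" "finite par" "E \<in> lang par"
    and \<Sigma>: "finite \<Sigma>" "sub_closed \<Sigma>" "\<Sigma> \<subseteq> lang (var \<union> par)" "E \<in> \<Sigma>" "Atom ` (var \<union> par) \<subseteq> \<Sigma>"
    and f: "\<And>p. p \<in> par \<Longrightarrow> f p = Atom p"
  shows "extendable var par E (types_within \<Sigma> (realised_types E f \<Sigma>))"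
proof -
  let ?B = "types_within \<Sigma> (realised_types E f \<Sigma>)"
  have subst_par: "subst f C = C" if "C \<in> lang par" for C
    using subst_id[OF f that] by blast
  have real: "\<exists>r. persistent r \<and> r \<tturnstile> E \<and> type_of \<Sigma> t = type_of \<Sigma> (pull f r)" if "t \<tturnstile> ?B" for t
  proof -
    have "type_of \<Sigma> t \<in> realised_types E f \<Sigma>"
      using that forces_types_within[OF \<Sigma>(1)] self_in_subtrees by blast
    then show ?thesis by (auto simp: realised_types_def)
  qed
  have agree: "t \<tturnstile> C \<longleftrightarrow> r \<tturnstile> subst f C" if "type_of \<Sigma> t = type_of \<Sigma> (pull f r)" "C \<in> \<Sigma>" for t r C
    using that by (auto simp: type_of_def forces_pull)
  show ?thesis
  proof
    show "?B \<in> lang (var \<union> par)" using types_within_lang \<Sigma> by blast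
    show "t \<tturnstile> E" if t: "persistent t" "t \<tturnstile> ?B" for t
    proof -
      obtain r where "r \<tturnstile> E" "type_of \<Sigma> t = type_of \<Sigma> (pull f r)" using real[OF t(2)] by blast
      then show ?thesis using agree[of t r E] \<Sigma>(4) subst_par assms(4) by simp
    qed
    fix V :: "'a set" and ts
    assume V: "persistent (Node V ts)" "Node V ts \<tturnstile> E" and ts: "\<forall>s\<in>set ts. s \<tturnstile> ?B"
    obtain R where R: "\<And>s. s \<in> set ts \<Longrightarrow> persistent (R s) \<and> R s \<tturnstile> E \<and>
        type_of \<Sigma> s = type_of \<Sigma> (pull f (R s))"
      using real ts by metis
    \<comment> \<open>Without variables at the root, persistence concerns only parameters, which
      \<open>f\<close> fixes.\<close>
    define r where "r = Node (V \<inter> par) (map R ts)"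
    define X where "X = {a \<in> var. r \<tturnstile> f a}"
    let ?t = "Node ((V - var) \<union> X) ts"
    have root: "a \<in> root s \<longleftrightarrow> R s \<tturnstile> f a" if "s \<in> set ts" "a \<in> var \<union> par" for s a
      using agree[of s "R s" "Atom a"] R[OF that(1)] that(2) \<Sigma>(5) by auto
    have "V \<inter> par \<subseteq> root (R s)" if "s \<in> set ts" for s
    proof
      fix p assume p: "p \<in> V \<inter> par"
      then have "p \<in> root s" using V(1) that by auto
      then show "p \<in> root (R s)" using root[OF that, of p] f p by auto
    qed
    then have pr: "persistent r" using R by (auto simp: r_def)
    \<comment> \<open>\<open>E\<close> transfers to \<open>r\<close> because \<open>s\<close> and
      \<open>R s\<close> agree on the parameter formulas of \<open>\<Sigma>\<close>.\<close>
    have "type_of (\<Sigma> \<inter> lang par) (Node V ts) = type_of (\<Sigma> \<inter> lang par) r"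
      unfolding r_def
    proof (rule type_of_Node_cong)
      have "type_of (\<Sigma> \<inter> lang par) s = type_of (\<Sigma> \<inter> lang par) (R s)" if "s \<in> set ts" for s
        using agree[of s "R s"] R[OF that] subst_par by (auto simp: type_of_def)
      then show "type_of (\<Sigma> \<inter> lang par) ` set ts = type_of (\<Sigma> \<inter> lang par) ` set (map R ts)"
        by (simp add: image_image)
    qed (use \<Sigma>(2) in \<open>auto simp: sub_closed_Int sub_closed_lang\<close>)
    then have rE: "r \<tturnstile> E" using V(2) \<Sigma>(4) assms(4) unfolding type_of_def by blast
    have "type_of \<Sigma> ?t = type_of \<Sigma> (Node {a. r \<tturnstile> f a} (map (pull f) (map R ts)))"
    proof (rule type_of_Node_cong)
      show "type_of \<Sigma> ` set ts = type_of \<Sigma> ` set (map (pull f) (map R ts))"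
        using R by (simp add: image_image)
      show "a \<in> (V - var) \<union> X \<longleftrightarrow> a \<in> {a. r \<tturnstile> f a}" if "Atom a \<in> \<Sigma>" for a
      proof (cases "a \<in> var")
        case False
        then have "a \<in> par" using that \<Sigma>(3) by auto
        then show ?thesis using False f by (auto simp: X_def r_def)
      qed (auto simp: X_def)
    qed (use \<Sigma>(2) in blast)
    then have "type_of \<Sigma> ?t = type_of \<Sigma> (pull f r)" by (simp add: r_def)
    then have "type_of \<Sigma> ?t \<in> realised_types E f \<Sigma>"
      using pr rE by (auto simp: realised_types_def)
    then have "?t \<tturnstile> ?B" using ts unfolding forces_types_within[OF \<Sigma>(1)] by auto
    moreover have "persistent ?t"
    proof -
      have "X \<subseteq> root s" if "s \<in> set ts" for s
      proof
        fix a assume a: "a \<in> X"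
        have "R s \<in> subtrees r" using that by (intro kid_in_subtrees) (simp add: r_def)
        then have "R s \<tturnstile> f a" using forces_subtree pr a by (auto simp: X_def)
        then show "a \<in> root s" using root[OF that] a by (auto simp: X_def)
      qed
      then show ?thesis using V(1) by auto
    qed
    ultimately show "\<exists>X\<subseteq>var. persistent (Node ((V - var) \<union> X) ts) \<and> Node ((V - var) \<union> X) ts \<tturnstile> ?B"
      by (intro exI[of _ X]) (auto simp: X_def)
  qed (use assms in auto)
qed

theorem projective_approximation:
  assumes "var \<inter> par = {}" "finite (var \<union> par)" "E \<in> lang par" "A \<in> lang (var \<union> par)"
  shows "\<exists>\<Pi>. finite \<Pi> \<and> (\<forall>B\<in>\<Pi>. projective var par E B \<and> {B} \<turnstile> A) \<and>
    (\<forall>\<theta>. substitution var par \<theta> \<longrightarrow> {} \<turnstile> E \<^bold>\<longrightarrow> \<theta> A \<longrightarrow> (\<exists>B\<in>\<Pi>. {} \<turnstile> E \<^bold>\<longrightarrow> \<theta> B))"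
proof -
  define \<Sigma> where "\<Sigma> = subfms A \<union> subfms E \<union> Atom ` (var \<union> par)"
  have fin: "finite var" "finite par" using assms(2) by auto
  have E: "E \<in> lang (var \<union> par)" using assms(3) lang_mono[of par "var \<union> par"] by blast
  have "subfms A \<subseteq> lang (var \<union> par)" "subfms E \<subseteq> lang (var \<union> par)"
    using subfms_lang assms(4) E by blast+
  then have \<Sigma>: "finite \<Sigma>" "sub_closed \<Sigma>" "\<Sigma> \<subseteq> lang (var \<union> par)" "E \<in> \<Sigma>" "A \<in> \<Sigma>"
    "Atom ` (var \<union> par) \<subseteq> \<Sigma>"
    using fin by (auto simp: \<Sigma>_def sub_closed_Un)
  \<comment> \<open>The candidates are indexed by sets of types over \<open>\<Sigma>\<close>, so
    they are finite in number before any \<open>\<theta>\<close> is given.\<close>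
  define \<Pi> where "\<Pi> = {B \<in> types_within \<Sigma> ` Pow (Pow \<Sigma>). projective var par E B \<and> {B} \<turnstile> A}"
  have "\<exists>B\<in>\<Pi>. {} \<turnstile> E \<^bold>\<longrightarrow> \<theta> B" if \<theta>: "substitution var par \<theta>" "{} \<turnstile> E \<^bold>\<longrightarrow> \<theta> A" for \<theta>
  proof -
    define f where "f = (\<lambda>a. \<theta> (Atom a))"
    define \<T> where "\<T> = realised_types E f \<Sigma>"
    let ?B = "types_within \<Sigma> \<T>"
    have f: "f p = Atom p" if "p \<in> par" for p
      using \<theta>(1) that by (simp add: f_def substitution_def)
    have A: "t \<tturnstile> subst f A" if "persistent t" "t \<tturnstile> E" for t
      using \<theta>(2) substitution_eq_subst[OF \<theta>(1) assms(4)] that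
      by (simp add: derivable_Imp_iff_forces f_def)
    interpret extendable var par E ?B
      unfolding \<T>_def using realised_types_extendable[of var par E \<Sigma> f] assms(1,3) fin \<Sigma> f by blast
    have "t \<tturnstile> A" if "t \<tturnstile> ?B" for t
    proof -
      have "type_of \<Sigma> t \<in> \<T>" using that forces_types_within[OF \<Sigma>(1)] self_in_subtrees by blast
      then obtain r where "persistent r" "r \<tturnstile> E" "type_of \<Sigma> t = type_of \<Sigma> (pull f r)"
        by (auto simp: \<T>_def realised_types_def)
      then show ?thesis using A[of r] \<Sigma>(5) unfolding type_of_def forces_pull by blast
    qed
    then have "{?B} \<turnstile> A" by (simp add: derivable1_iff_forces)
    moreover have "\<T> \<in> Pow (Pow \<Sigma>)" by (auto simp: \<T>_def realised_types_def type_of_def)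
    ultimately have "?B \<in> \<Pi>" using projective by (simp add: \<Pi>_def)
    moreover have "t \<tturnstile> \<theta> ?B" if t: "persistent t" "t \<tturnstile> E" for t
    proof -
      \<comment> \<open>All nodes above a model of \<open>E\<close> are themselves models of
        \<open>E\<close>, so their images have types in \<open>\<T>\<close>.\<close>
      have "type_of \<Sigma> (pull f s) \<in> \<T>" if "s \<in> subtrees t" for s
        using that t persistent_subtree[OF that t(1)] forces_subtree[OF t(2,1) that]
        by (auto simp: \<T>_def realised_types_def)
      then have "pull f t \<tturnstile> ?B" by (simp add: forces_types_within[OF \<Sigma>(1)] subtrees_pull)
      then show ?thesis
        using substitution_eq_subst[OF \<theta>(1) B_lang] by (simp add: forces_pull f_def)
    qed
    ultimately show ?thesis unfolding derivable_Imp_iff_forces by blast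
  qed
  moreover have "finite \<Pi>" using \<Sigma>(1) by (simp add: \<Pi>_def)
  ultimately show ?thesis by (intro exI[of _ \<Pi>]) (auto simp: \<Pi>_def)
qed

theorem theorem5p6:
  fixes var par :: "'a set" and \<Gamma> :: "'a fm set" and A :: "'a fm"
  assumes "var \<inter> par = {}"
    and "finite (var \<union> par)"
    and "finite \<Gamma>" and "\<Gamma> \<subseteq> lang (var \<union> par)"
    and "A \<in> lang (var \<union> par)"
  shows "\<exists>\<Pi>. finite \<Pi> \<and> (\<forall>B \<in> \<Pi>. set_projective var par \<Gamma> B) \<and>
           {} \<turnstile> (\<^bold>\<Or>\<Pi>) \<^bold>\<longrightarrow> A \<and>
           admissible var par \<Gamma> A \<Pi>"
proof -
  have "\<forall>E\<in>lang par. \<exists>\<Pi>. finite \<Pi> \<and> (\<forall>B\<in>\<Pi>. projective var par E B \<and> {B} \<turnstile> A) \<and>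
      (\<forall>\<theta>. substitution var par \<theta> \<longrightarrow> {} \<turnstile> E \<^bold>\<longrightarrow> \<theta> A \<longrightarrow> (\<exists>B\<in>\<Pi>. {} \<turnstile> E \<^bold>\<longrightarrow> \<theta> B))"
    (is "\<forall>E\<in>lang par. \<exists>\<Pi>. ?approx E \<Pi>")
  proof
    fix E assume "E \<in> lang par"
    from projective_approximation[OF assms(1,2) this assms(5)] show "\<exists>\<Pi>. ?approx E \<Pi>" .
  qed
  from bchoice[OF this] obtain P where P: "\<forall>E\<in>lang par. ?approx E (P E)" ..
  \<comment> \<open>\<open>\<Gamma>\<close> is finite, so the union is too, and each member is
    projective for the \<open>E\<close> it comes from.\<close>
  define \<Pi> where "\<Pi> = (\<Union>E\<in>\<Gamma> \<inter> lang par. P E)"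
  have fin: "finite \<Pi>" using assms(3) P by (auto simp: \<Pi>_def)
  moreover have "\<forall>B\<in>\<Pi>. set_projective var par \<Gamma> B"
    using P unfolding \<Pi>_def set_projective_def by blast
  moreover have "{} \<turnstile> (\<^bold>\<Or>\<Pi>) \<^bold>\<longrightarrow> A"
    unfolding derivable_Imp_iff_forces forces_BigDisj[OF fin]
    using P unfolding \<Pi>_def derivable1_iff_forces by blast
  moreover have "admissible var par \<Gamma> A \<Pi>"
    unfolding admissible_def
  proof (intro ballI allI impI)
    fix E \<theta> assume E: "E \<in> \<Gamma> \<inter> lang par"
      and "substitution var par \<theta>" "{} \<turnstile> E \<^bold>\<longrightarrow> \<theta> A"
    then obtain B where "B \<in> P E" "{} \<turnstile> E \<^bold>\<longrightarrow> \<theta> B" using P by blast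
    then show "\<exists>B\<in>\<Pi>. {} \<turnstile> E \<^bold>\<longrightarrow> \<theta> B" using E by (auto simp: \<Pi>_def)
  qed
  ultimately show ?thesis by blast
qed

end
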